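(* Let $r>0$ and let $S=(S_u)_{u=0,\dots,T}$ be a nonnegative adapted stock price process. (i) For every tax rate $\alpha\in[0,1)$: if $S$ satisfies (RLNA), then $S$ satisfies (NA). (ii) For $\alpha=0$: $S$ satisfies (RLNA) if and only if $S$ satisfies (NA).
   Context: Setting. Fix $T\in\mathbb{N}=\{1,2,\dots\}$ and a filtered probability space $(\Omega,\mathcal{F},(\mathcal{F}_t)_{t=0,1,\ldots,T},P)$. There is one non-shortable risky stock with price process $S=(S_t)_{t=0,\ldots,T}$, $S_t\in L^0_+(\Omega,\mathcal{F}_t,P)$ (nonnegative real-valued $\mathcal{F}_t$-measurable random variables). The riskless interest rate is a constant $r>0$ and the tax rate a constant $\alpha\in[0,1)$. Strategies. A stock strategy is a family $N=(N_{s,u})_{0\le s\le u\le T}$ with $N_{s,u}\in L^0_+(\Omega,\mathcal{F}_u,P)$ and $N_{s,s}\ge N_{s,s+1}\ge\dots\ge N_{s,T}=0$ for all $s\in\{0,\dots,T\}$ ($N_{s,u}$ is the number of shares bought at time $s$ and still held after trading at time $u$). A pair $(\eta,N)$ with $N$ a stock strategy and $\eta=(\eta_u)_{u=0,\dots,T}$, $\eta_u\in L^0(\Omega,\mathcal{F}_u,P)$, is self-financing for zero initial capital iff, with $\eta_{-1}:=0$, for all $u\in\{0,\dots,T\}$, $$\eta_u-\eta_{u-1}=(1-\alpha)r\,\eta_{u-1}-N_{u,u}S_u+\sum_{s=0}^{u-1}(N_{s,u-1}-N_{s,u})\bigl(S_u-\alpha(S_u-S_s)\bigr).\qquad( * )$$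 It is an arbitrage iff $P(\eta_T\ge0)=1$ and $P(\eta_T>0)>0$. The model (or the price process $S$) satisfies no-arbitrage (NA) iff no arbitrage exists. Model with eliminated period $t\in\{1,\dots,T\}$. The time domain is $D=\{0,\dots,t-1,t+1,\dots,T\}$ and the price process is a nonnegative adapted process $\widehat S=(\widehat S_u)_{u\in D}$ ($\widehat S_u$ is $\mathcal{F}_u$-measurable). A strategy is a family of nonnegative random variables $N=(N_{s,u})_{s,u\in D,\,s\le u}$, nonincreasing in $u\in D$ for each fixed $s$, with $N_{s,T}=0$ for all $s$, where $N_{s,u}$ is $\mathcal{F}_u$-measurable if $u\ne t-1$, whereas $N_{s,t-1}$ only has to be $\mathcal{F}_t$-measurable. The process $\eta=(\eta_u)_{u\in D}$ starts from zero initial capital and satisfies $( * )$ with $\widehat S$ in place of $S$ (and sums over $s\in D$) for $u\in D\setminus\{t+1\}$ (so $\eta_{t-1}$ is only required to be $\mathcal{F}_t$-measurable), and for $u=t+1$ the condition is replaced by $$\eta_{t+1}-\eta_{t-1}=(1-\alpha)r\,\eta_{t-1}-N_{t+1,t+1}\widehat S_{t+1}+\sum_{s=0}^{t-1}(N_{s,t-1}-N_{s,t+1})\bigl(\widehat S_{t+1}-\alpha(\widehat S_{t+1}-\widehat S_s)\bigr).$$ The liquidation value is $\eta_T$. In the special case $t=T$, one requires $N_{s,T-1}=0$ for $s=0,\dots,T-1$, the liquidation value is $\eta_{T-1}$, and the last display does not apply. $\widehat S$ satisfies (NA) in this model iff no such $(\eta,N)$ has a liquidation value that is $\ge0$ almost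 surely and $>0$ with positive probability. Robust local no-arbitrage. $S$ satisfies (RLNA) in period $t$ iff $P(S_{t-1}=0,S_t>0)=0$ and for every nonnegative adapted process $\widehat S=(\widehat S_u)_{u\in D}$ on $D=\{0,\dots,t-1,t+1,\dots,T\}$ the following implication holds: if $\widehat S$ satisfies (NA) in the model with eliminated period $t$, then the process $\widetilde S=(\widetilde S_u)_{u=0,\dots,T}$ defined by $$\widetilde S_u:=\widehat S_u\ (u\le t-1),\qquad \widetilde S_t:=\widehat S_{t-1}\frac{S_t}{S_{t-1}},\qquad \widetilde S_u:=\widehat S_u\frac{S_t}{S_{t-1}}\ (u\ge t+1),$$ with the convention $0/0:=0$, satisfies (NA) (in the original model on $\{0,\dots,T\}$, with $\widetilde S$ in place of $S$). $S$ satisfies (RLNA) iff it satisfies (RLNA) in every period $t\in\{1,\dots,T\}$. *)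

theory Defs
  imports "HOL-Probability.Probability"
begin

text \<open>
  Time is indexed by natural numbers, but only the values at the dates of the relevant time
  domain enter the definitions below. Random variables are real functions; all relations between
  them (nonnegativity, monotonicity, the self-financing equations) are understood almost surely,
  as for elements of $L^0$, whereas measurability is with respect to the stated, not necessarily
  complete, sigma-algebra.
\<close>

locale filtered_prob_space = prob_space M
  for M :: "'a measure" and F :: "nat \<Rightarrow> 'a measure" and T :: nat +
  assumes subalgebra_F: "t \<le> T \<Longrightarrow> subalgebra M (F t)"
    and F_mono: "s \<le> t \<Longrightarrow> t \<le> T \<Longrightarrow> sets (F s) \<subseteq> sets (F t)"

definition L0_plus :: "'a measure \<Rightarrow> 'a measure \<Rightarrow> ('a \<Rightarrow> real) set" where
  "L0_plus M G = {X \<in> borel_measurable G. AE \<omega> in M. 0 \<le> X \<omega>}"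

definition price_process ::
    "'a measure \<Rightarrow> (nat \<Rightarrow> 'a measure) \<Rightarrow> nat set \<Rightarrow> (nat \<Rightarrow> 'a \<Rightarrow> real) \<Rightarrow> bool" where
  "price_process M F D S \<longleftrightarrow> (\<forall>u\<in>D. S u \<in> L0_plus M (F u))"

text \<open>
  The self-financing equation at date \<open>u\<close> with previous trading date \<open>v\<close>; \<open>I\<close> is the set of earlier
  purchase dates, and \<open>b\<close> is the previous bank account position, which is zero at date 0. (At date 0
  the set \<open>I\<close> is empty, so \<open>v\<close> is immaterial.)
\<close>

definition budget_equation ::
    "real \<Rightarrow> real \<Rightarrow> (nat \<Rightarrow> 'a \<Rightarrow> real) \<Rightarrow> (nat \<Rightarrow> nat \<Rightarrow> 'a \<Rightarrow> real) \<Rightarrow> (nat \<Rightarrow> 'a \<Rightarrow> real) \<Rightarrow>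
      nat set \<Rightarrow> nat \<Rightarrow> nat \<Rightarrow> 'a \<Rightarrow> bool" where
  "budget_equation r \<alpha> S N \<eta> I v u \<omega> \<longleftrightarrow>
     (let b = (if u = 0 then 0 else \<eta> v \<omega>) in
      \<eta> u \<omega> - b = (1 - \<alpha>) * r * b - N u u \<omega> * S u \<omega>
        + (\<Sum>s\<in>I. (N s v \<omega> - N s u \<omega>) * (S u \<omega> - \<alpha> * (S u \<omega> - S s \<omega>))))"

definition stock_strategy ::
    "'a measure \<Rightarrow> (nat \<Rightarrow> 'a measure) \<Rightarrow> nat \<Rightarrow> (nat \<Rightarrow> nat \<Rightarrow> 'a \<Rightarrow> real) \<Rightarrow> bool" where
  "stock_strategy M F T N \<longleftrightarrow>
     (\<forall>s u. s \<le> u \<and> u \<le> T \<longrightarrow> N s u \<in> L0_plus M (F u)) \<and>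
     (\<forall>s u. s \<le> u \<and> u < T \<longrightarrow> (AE \<omega> in M. N s (Suc u) \<omega> \<le> N s u \<omega>)) \<and>
     (\<forall>s\<le>T. AE \<omega> in M. N s T \<omega> = 0)"

definition self_financing ::
    "'a measure \<Rightarrow> (nat \<Rightarrow> 'a measure) \<Rightarrow> nat \<Rightarrow> real \<Rightarrow> real \<Rightarrow> (nat \<Rightarrow> 'a \<Rightarrow> real) \<Rightarrow>
      (nat \<Rightarrow> 'a \<Rightarrow> real) \<Rightarrow> (nat \<Rightarrow> nat \<Rightarrow> 'a \<Rightarrow> real) \<Rightarrow> bool" where
  "self_financing M F T r \<alpha> S \<eta> N \<longleftrightarrow>
     (\<forall>u\<le>T. \<eta> u \<in> borel_measurable (F u)) \<and>
     (\<forall>u\<le>T. AE \<omega> in M. budget_equation r \<alpha> S N \<eta> {..<u} (u - 1) u \<omega>)"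

definition NA ::
    "'a measure \<Rightarrow> (nat \<Rightarrow> 'a measure) \<Rightarrow> nat \<Rightarrow> real \<Rightarrow> real \<Rightarrow> (nat \<Rightarrow> 'a \<Rightarrow> real) \<Rightarrow> bool" where
  "NA M F T r \<alpha> S \<longleftrightarrow>
     \<not> (\<exists>\<eta> N. stock_strategy M F T N \<and> self_financing M F T r \<alpha> S \<eta> N \<and>
          \<P>(\<omega> in M. 0 \<le> \<eta> T \<omega>) = 1 \<and> \<P>(\<omega> in M. 0 < \<eta> T \<omega>) > 0)"

definition elim_domain :: "nat \<Rightarrow> nat \<Rightarrow> nat set" where
  "elim_domain T t = {0..T} - {t}"

definition elim_info :: "(nat \<Rightarrow> 'a measure) \<Rightarrow> nat \<Rightarrow> nat \<Rightarrow> 'a measure" where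
  "elim_info F t u = (if u = t - 1 then F t else F u)"

definition elim_horizon :: "nat \<Rightarrow> nat \<Rightarrow> nat" where
  "elim_horizon T t = (if t = T then T - 1 else T)"

definition elim_stock_strategy ::
    "'a measure \<Rightarrow> (nat \<Rightarrow> 'a measure) \<Rightarrow> nat \<Rightarrow> nat \<Rightarrow> (nat \<Rightarrow> nat \<Rightarrow> 'a \<Rightarrow> real) \<Rightarrow> bool" where
  "elim_stock_strategy M F T t N \<longleftrightarrow>
     (\<forall>s\<in>elim_domain T t. \<forall>u\<in>elim_domain T t.
        s \<le> u \<longrightarrow> N s u \<in> L0_plus M (elim_info F t u)) \<and>
     (\<forall>s\<in>elim_domain T t. \<forall>u\<in>elim_domain T t. \<forall>v\<in>elim_domain T t.
        s \<le> u \<and> u \<le> v \<longrightarrow> (AE \<omega> in M. N s v \<omega> \<le> N s u \<omega>)) \<and>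
     (\<forall>s\<in>elim_domain T t. AE \<omega> in M. N s (elim_horizon T t) \<omega> = 0)"

definition elim_self_financing ::
    "'a measure \<Rightarrow> (nat \<Rightarrow> 'a measure) \<Rightarrow> nat \<Rightarrow> nat \<Rightarrow> real \<Rightarrow> real \<Rightarrow> (nat \<Rightarrow> 'a \<Rightarrow> real) \<Rightarrow>
      (nat \<Rightarrow> 'a \<Rightarrow> real) \<Rightarrow> (nat \<Rightarrow> nat \<Rightarrow> 'a \<Rightarrow> real) \<Rightarrow> bool" where
  "elim_self_financing M F T t r \<alpha> S \<eta> N \<longleftrightarrow>
     (\<forall>u\<in>elim_domain T t. \<eta> u \<in> borel_measurable (elim_info F t u)) \<and>
     (\<forall>u\<in>elim_domain T t - {t + 1}. AE \<omega> in M.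
        budget_equation r \<alpha> S N \<eta> {s \<in> elim_domain T t. s < u} (u - 1) u \<omega>) \<and>
     (t < T \<longrightarrow> (AE \<omega> in M. budget_equation r \<alpha> S N \<eta> {0..t - 1} (t - 1) (t + 1) \<omega>))"

definition elim_NA ::
    "'a measure \<Rightarrow> (nat \<Rightarrow> 'a measure) \<Rightarrow> nat \<Rightarrow> nat \<Rightarrow> real \<Rightarrow> real \<Rightarrow> (nat \<Rightarrow> 'a \<Rightarrow> real) \<Rightarrow> bool" where
  "elim_NA M F T t r \<alpha> S \<longleftrightarrow>
     \<not> (\<exists>\<eta> N. elim_stock_strategy M F T t N \<and> elim_self_financing M F T t r \<alpha> S \<eta> N \<and>
          \<P>(\<omega> in M. 0 \<le> \<eta> (elim_horizon T t) \<omega>) = 1 \<and>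
          \<P>(\<omega> in M. 0 < \<eta> (elim_horizon T t) \<omega>) > 0)"

text \<open>
  The convention $0/0 = 0$ is the one of the library, where \<open>x / 0 = 0\<close> for every \<open>x\<close>; the values
  with \<open>x > 0\<close> occur only on a null set whenever the process is used in the definition of (RLNA).
\<close>

definition insert_period ::
    "nat \<Rightarrow> (nat \<Rightarrow> 'a \<Rightarrow> real) \<Rightarrow> (nat \<Rightarrow> 'a \<Rightarrow> real) \<Rightarrow> nat \<Rightarrow> 'a \<Rightarrow> real" where
  "insert_period t S S' u \<omega> =
     (if u < t then S' u \<omega>
      else if u = t then S' (t - 1) \<omega> * (S t \<omega> / S (t - 1) \<omega>)
      else S' u \<omega> * (S t \<omega> / S (t - 1) \<omega>))"

definition RLNA_in_period ::
    "'a measure \<Rightarrow> (nat \<Rightarrow> 'a measure) \<Rightarrow> nat \<Rightarrow> real \<Rightarrow> real \<Rightarrow> (nat \<Rightarrow> 'a \<Rightarrow> real) \<Rightarrow> nat \<Rightarrow> bool" where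
  "RLNA_in_period M F T r \<alpha> S t \<longleftrightarrow>
     \<P>(\<omega> in M. S (t - 1) \<omega> = 0 \<and> S t \<omega> > 0) = 0 \<and>
     (\<forall>S'. price_process M F (elim_domain T t) S' \<longrightarrow> elim_NA M F T t r \<alpha> S' \<longrightarrow>
        NA M F T r \<alpha> (insert_period t S S'))"

definition RLNA ::
    "'a measure \<Rightarrow> (nat \<Rightarrow> 'a measure) \<Rightarrow> nat \<Rightarrow> real \<Rightarrow> real \<Rightarrow> (nat \<Rightarrow> 'a \<Rightarrow> real) \<Rightarrow> bool" where
  "RLNA M F T r \<alpha> S \<longleftrightarrow> (\<forall>t\<in>{1..T}. RLNA_in_period M F T r \<alpha> S t)"

end

theory Submission
  imports Defs
begin

text \<open>
  The price process stopped at 0 is arbitrage-free. Inserting the return \<open>S\<^sub>k / S\<^bsub>k-1\<^esub>\<close> into the process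
  stopped at \<open>k - 1\<close> yields the process stopped at \<open>k\<close>, so (i) follows by induction on \<open>k\<close>
  once the process stopped at \<open>k - 1\<close> is arbitrage-free in the model with eliminated period \<open>k\<close>.
  There, the prices no longer move from date \<open>k - 1\<close> on, and selling everything at that date is
  optimal; this needs no information from \<open>F\<^sub>k\<close> and is thus possible in the original model.

  Without taxes, (NA) reduces to the absence of one-period arbitrages. A one-period arbitrage for the
  process with an inserted return becomes, after rescaling by the appropriate nonnegative random
  variable, one for \<open>S\<close> in period \<open>t\<close> or one in the model with eliminated period.
\<close>

section \<open>Liquidation values and the budget equation\<close>

text \<open>For \<open>s = u\<close> the bracket is just \<open>S u \<omega>\<close>: a purchase
  made at \<open>u\<close> carries no taxable gain and is valued at its cost.\<close>

definition liquidation_value ::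
    "real \<Rightarrow> real \<Rightarrow> (nat \<Rightarrow> 'a \<Rightarrow> real) \<Rightarrow> (nat \<Rightarrow> nat \<Rightarrow> 'a \<Rightarrow> real) \<Rightarrow> (nat \<Rightarrow> 'a \<Rightarrow> real) \<Rightarrow>
      nat \<Rightarrow> 'a \<Rightarrow> real" where
  "liquidation_value r \<alpha> S N \<eta> u \<omega> =
     \<eta> u \<omega> + (\<Sum>s\<le>u. N s u \<omega> * (S u \<omega> - \<alpha> * (S u \<omega> - S s \<omega>)))"

text \<open>The liquidation value before trading at \<open>u\<close>, so that only earlier positions enter.\<close>

definition pre_trade_value ::
    "real \<Rightarrow> real \<Rightarrow> (nat \<Rightarrow> 'a \<Rightarrow> real) \<Rightarrow> (nat \<Rightarrow> nat \<Rightarrow> 'a \<Rightarrow> real) \<Rightarrow> (nat \<Rightarrow> 'a \<Rightarrow> real) \<Rightarrow>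
      nat \<Rightarrow> 'a \<Rightarrow> real" where
  "pre_trade_value r \<alpha> S N \<eta> u \<omega> =
     (if u = 0 then 0 else (1 + (1 - \<alpha>) * r) * \<eta> (u - 1) \<omega>
        + (\<Sum>s<u. N s (u - 1) \<omega> * (S u \<omega> - \<alpha> * (S u \<omega> - S s \<omega>))))"

text \<open>A sale yields exactly the after-tax amount at which the shares were already counted, and
  a purchase is counted at cost. Being self-financing at \<open>u\<close> is therefore conservation
  of the liquidation value across the trade.\<close>

lemma budget_equation_iff_liquidation_value:
  "budget_equation r \<alpha> S N \<eta> {..<u} (u - 1) u \<omega> \<longleftrightarrow>
     liquidation_value r \<alpha> S N \<eta> u \<omega> = pre_trade_value r \<alpha> S N \<eta> u \<omega>"
proof -
  let ?X = "\<lambda>s. S u \<omega> - \<alpha> * (S u \<omega> - S s \<omega>)"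
  define A where "A = (\<Sum>s<u. N s (u - 1) \<omega> * ?X s)"
  define B where "B = (\<Sum>s<u. N s u \<omega> * ?X s)"
  have "(\<Sum>s\<le>u. N s u \<omega> * ?X s) = B + N u u \<omega> * S u \<omega>"
    by (simp add: lessThan_Suc_atMost[symmetric] B_def)
  moreover have "(\<Sum>s<u. (N s (u - 1) \<omega> - N s u \<omega>) * ?X s) = A - B"
    by (simp only: left_diff_distrib sum_subtractf A_def B_def)
  moreover have "A = 0" "B = 0" if "u = 0"
    using that by (simp_all add: A_def B_def)
  ultimately show ?thesis
    unfolding budget_equation_def liquidation_value_def pre_trade_value_def Let_def A_def[symmetric]
    by (cases "u = 0") (simp_all only: if_True if_False, auto simp: ring_distribs)
qed

section \<open>Reformulations of (NA) and liquidation at an early date\<close>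

context filtered_prob_space
begin

lemma space_F: "t \<le> T \<Longrightarrow> space (F t) = space M"
  using subalgebra_F by (auto simp: subalgebra_def)

lemma borel_measurable_F_mono:
  assumes "s \<le> t" "t \<le> T" "X \<in> borel_measurable (F s)"
  shows "X \<in> borel_measurable (F t)"
  using assms F_mono[of s t] space_F[of s] space_F[of t]
  by (auto simp: measurable_def)

lemma borel_measurable_F_M:
  assumes "t \<le> T" "X \<in> borel_measurable (F t)"
  shows "X \<in> borel_measurable M"
  using measurable_from_subalg[OF subalgebra_F] assms by blast

lemma prob_nonneg_and_pos_iff:
  assumes [measurable]: "X \<in> borel_measurable M"
  shows "\<P>(\<omega> in M. 0 \<le> X \<omega>) = 1 \<and> \<P>(\<omega> in M. 0 < X \<omega>) > (0::real) \<longleftrightarrow>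
    (AE \<omega> in M. 0 \<le> X \<omega>) \<and> \<not> (AE \<omega> in M. X \<omega> \<le> (0::real))"
proof -
  have "\<P>(\<omega> in M. 0 < X \<omega>) > 0 \<longleftrightarrow> \<P>(\<omega> in M. 0 < X \<omega>) \<noteq> 0"
    by (simp add: zero_less_measure_iff)
  also have "\<dots> \<longleftrightarrow> \<not> (AE \<omega> in M. X \<omega> \<le> 0)"
    by (subst prob_Collect_eq_0) (auto simp: not_less)
  finally show ?thesis by (subst prob_Collect_eq_1) auto
qed

lemma NA_iff:
  "NA M F T r \<alpha> S \<longleftrightarrow>
     (\<forall>\<eta> N. stock_strategy M F T N \<longrightarrow> self_financing M F T r \<alpha> S \<eta> N \<longrightarrow>
        (AE \<omega> in M. 0 \<le> \<eta> T \<omega>) \<longrightarrow> (AE \<omega> in M. \<eta> T \<omega> \<le> 0))"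
proof -
  have "\<P>(\<omega> in M. 0 \<le> \<eta> T \<omega>) = 1 \<and> \<P>(\<omega> in M. 0 < \<eta> T \<omega>) > 0 \<longleftrightarrow>
      (AE \<omega> in M. 0 \<le> \<eta> T \<omega>) \<and> \<not> (AE \<omega> in M. \<eta> T \<omega> \<le> 0)"
    if "self_financing M F T r \<alpha> S \<eta> N" for \<eta> N
    using that borel_measurable_F_M[of T]
    by (intro prob_nonneg_and_pos_iff) (auto simp: self_financing_def)
  then show ?thesis
    unfolding NA_def by blast
qed

text \<open>Used for processes with an inserted return, which agree with a stopped process only up
  to a null set because of divisions by zero.\<close>

lemma NA_cong_AE:
  assumes eq: "\<And>u. u \<le> T \<Longrightarrow> AE \<omega> in M. S u \<omega> = S' u \<omega>" and "NA M F T r \<alpha> S"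
  shows "NA M F T r \<alpha> S'"
proof -
  have "AE \<omega> in M. \<forall>u\<in>{..T}. S u \<omega> = S' u \<omega>"
    using eq by (subst AE_finite_all) auto
  then have all: "AE \<omega> in M. \<forall>u\<le>T. S u \<omega> = S' u \<omega>" by eventually_elim auto
  have "self_financing M F T r \<alpha> S \<eta> N" if sf: "self_financing M F T r \<alpha> S' \<eta> N" for \<eta> N
    unfolding self_financing_def
  proof (intro conjI allI impI)
    fix u assume u: "u \<le> T"
    show "\<eta> u \<in> borel_measurable (F u)" using sf u by (auto simp: self_financing_def)
    have "AE \<omega> in M. budget_equation r \<alpha> S' N \<eta> {..<u} (u - 1) u \<omega>"
      using sf u by (auto simp: self_financing_def)
    with all show "AE \<omega> in M. budget_equation r \<alpha> S N \<eta> {..<u} (u - 1) u \<omega>"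
    proof eventually_elim
      case (elim \<omega>)
      have "(\<Sum>s<u. (N s (u - 1) \<omega> - N s u \<omega>) * (S u \<omega> - \<alpha> * (S u \<omega> - S s \<omega>))) =
            (\<Sum>s<u. (N s (u - 1) \<omega> - N s u \<omega>) * (S' u \<omega> - \<alpha> * (S' u \<omega> - S' s \<omega>)))"
        using elim(1) u by (intro sum.cong) auto
      then show ?case using elim u by (simp add: budget_equation_def)
    qed
  qed
  with assms(2) show ?thesis unfolding NA_iff by blast
qed

text \<open>Selling everything at \<open>m\<close> and leaving the proceeds in the bank until
  \<open>T\<close> completes the strategy, so a nonnegative value at \<open>m\<close> that is not
  almost surely zero would give an arbitrage. The assumptions on \<open>N\<close> and
  \<open>\<eta>\<close> concern dates before \<open>m\<close> only; strategies from a model that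
  coincides up to then can be inserted.\<close>

lemma pre_trade_value_nonpos_if_NA:
  assumes m: "m \<le> T" and S: "\<And>u. u \<le> m \<Longrightarrow> S u \<in> borel_measurable (F u)"
    and N: "\<And>s u. s \<le> u \<Longrightarrow> u < m \<Longrightarrow> N s u \<in> L0_plus M (F u)"
    and mono: "\<And>s u. s \<le> u \<Longrightarrow> Suc u < m \<Longrightarrow> AE \<omega> in M. N s (Suc u) \<omega> \<le> N s u \<omega>"
    and \<eta>: "\<And>u. u < m \<Longrightarrow> \<eta> u \<in> borel_measurable (F u)"
    and budget: "\<And>u. u < m \<Longrightarrow> AE \<omega> in M. budget_equation r \<alpha> S N \<eta> {..<u} (u - 1) u \<omega>"
    and NA: "NA M F T r \<alpha> S" and nonneg: "AE \<omega> in M. 0 \<le> pre_trade_value r \<alpha> S N \<eta> m \<omega>"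
    and r: "0 < 1 + (1 - \<alpha>) * r"
  shows "AE \<omega> in M. pre_trade_value r \<alpha> S N \<eta> m \<omega> \<le> 0"
proof -
  let ?W = "pre_trade_value r \<alpha> S N \<eta> m"
  define N' where "N' s u \<omega> = (if u < m then N s u \<omega> else 0)" for s u \<omega>
  define \<eta>' where
    "\<eta>' u \<omega> = (if u < m then \<eta> u \<omega> else (1 + (1 - \<alpha>) * r) ^ (u - m) * ?W \<omega>)" for u \<omega>
  have strat: "stock_strategy M F T N'"
    unfolding stock_strategy_def
  proof (intro conjI allI impI; (elim conjE)?)
    fix s u assume "s \<le> u" "u \<le> T"
    then show "N' s u \<in> L0_plus M (F u)"
      using N[of s u] by (cases "u < m") (auto simp: N'_def[abs_def] L0_plus_def)
  next
    fix s u assume "s \<le> u" "u < T"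
    then show "AE \<omega> in M. N' s (Suc u) \<omega> \<le> N' s u \<omega>"
      using N[of s u] mono[of s u] by (cases "Suc u < m") (auto simp: N'_def L0_plus_def)
  next
    fix s show "AE \<omega> in M. N' s T \<omega> = 0" using m by (simp add: N'_def)
  qed
  have W: "?W \<in> borel_measurable (F u)" if "m \<le> u" "u \<le> T" for u
  proof -
    have [measurable]: "S s \<in> borel_measurable (F m)" if "s \<le> m" for s
      using S[of s] that m by (intro borel_measurable_F_mono[of s m]) auto
    have [measurable]: "N s (m - 1) \<in> borel_measurable (F m)" if "s < m" for s
      using N[of s "m - 1"] that m
      by (intro borel_measurable_F_mono[of "m - 1" m]) (auto simp: L0_plus_def)
    have [measurable]: "\<eta> (m - 1) \<in> borel_measurable (F m)" if "m \<noteq> 0"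
      using \<eta>[of "m - 1"] that m by (intro borel_measurable_F_mono[of "m - 1" m]) auto
    have "?W \<in> borel_measurable (F m)"
      unfolding pre_trade_value_def[abs_def]
      by (cases "m = 0") (auto intro!: borel_measurable_add borel_measurable_sum
          borel_measurable_times borel_measurable_diff simp del: One_nat_def)
    then show ?thesis using that borel_measurable_F_mono by blast
  qed
  have sf: "self_financing M F T r \<alpha> S \<eta>' N'"
    unfolding self_financing_def
  proof (intro conjI allI impI)
    fix u assume u: "u \<le> T"
    show "\<eta>' u \<in> borel_measurable (F u)"
      using \<eta>[of u] W[of u] u by (cases "u < m") (auto simp: \<eta>'_def[abs_def])
    show "AE \<omega> in M. budget_equation r \<alpha> S N' \<eta>' {..<u} (u - 1) u \<omega>"
    proof (cases "u < m")
      case True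
      then have *: "u - 1 < m" by simp
      show ?thesis using budget[OF True]
        by eventually_elim
          (simp add: budget_equation_def N'_def \<eta>'_def True * del: One_nat_def split: if_splits)
    next
      case False
      have "budget_equation r \<alpha> S N' \<eta>' {..<u} (u - 1) u \<omega>" for \<omega>
      proof (cases "u = m")
        \<comment> \<open>All positions are closed at \<open>m\<close>, so the liquidation value is
          the bank account, which was defined to be \<open>?W\<close> there.\<close>
        case True
        then show ?thesis unfolding budget_equation_iff_liquidation_value
          by (auto simp: liquidation_value_def pre_trade_value_def N'_def \<eta>'_def)
      next
        case neq: False
        with False have "u - m = Suc (u - 1 - m)" "\<not> u - 1 < m" "u \<noteq> 0" by auto
        then show ?thesis using False
          by (simp add: budget_equation_def N'_def \<eta>'_def algebra_simps)
      qed
      then show ?thesis by simp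
    qed
  qed
  have T: "\<eta>' T \<omega> = (1 + (1 - \<alpha>) * r) ^ (T - m) * ?W \<omega>" for \<omega> using m by (simp add: \<eta>'_def)
  have "AE \<omega> in M. 0 \<le> \<eta>' T \<omega>"
    using nonneg by eventually_elim (use r in \<open>simp add: T\<close>)
  then have "AE \<omega> in M. \<eta>' T \<omega> \<le> 0" using NA strat sf unfolding NA_iff by blast
  then show ?thesis
    by eventually_elim (use zero_less_power[OF r, of "T - m"] in \<open>auto simp: T mult_le_0_iff\<close>)
qed

section \<open>Pathwise estimates and constant prices\<close>

text \<open>There are finitely many dates, so one null set serves all of them and later arguments
  can be carried out path by path.\<close>

lemma stock_strategy_nonneg:
  assumes "stock_strategy M F T N"
  shows "AE \<omega> in M. \<forall>u\<le>T. \<forall>s\<le>u. 0 \<le> N s u \<omega>"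
proof -
  have "AE \<omega> in M. \<forall>u\<in>{..T}. \<forall>s\<in>{..u}. 0 \<le> N s u \<omega>"
    using assms by (auto simp: AE_finite_all stock_strategy_def L0_plus_def)
  then show ?thesis by eventually_elim auto
qed

lemma self_financing_AE:
  assumes "self_financing M F T r \<alpha> S \<eta> N"
  shows "AE \<omega> in M. \<forall>u\<le>T.
    liquidation_value r \<alpha> S N \<eta> u \<omega> = pre_trade_value r \<alpha> S N \<eta> u \<omega>"
proof -
  have "AE \<omega> in M. \<forall>u\<in>{..T}.
      liquidation_value r \<alpha> S N \<eta> u \<omega> = pre_trade_value r \<alpha> S N \<eta> u \<omega>"
    using assms by (auto simp: AE_finite_all self_financing_def
        budget_equation_iff_liquidation_value[symmetric])
  then show ?thesis by eventually_elim auto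
qed

lemma stock_strategy_liquidation_value_T:
  assumes "stock_strategy M F T N"
  shows "AE \<omega> in M. liquidation_value r \<alpha> S N \<eta> T \<omega> = \<eta> T \<omega>"
proof -
  have "AE \<omega> in M. \<forall>s\<in>{..T}. N s T \<omega> = 0"
    using assms by (auto simp: AE_finite_all stock_strategy_def)
  then show ?thesis by eventually_elim (auto simp: liquidation_value_def)
qed

text \<open>Once the price is constant, shares earn nothing whereas the bank account earns interest, so
  immediate liquidation is optimal, tax deferral notwithstanding.\<close>

lemma terminal_value_le_if_constant_price:
  assumes \<alpha>: "0 \<le> \<alpha>" "\<alpha> < 1" and r: "0 < r" and m: "m \<le> T"
    and S: "\<And>u. u \<le> T \<Longrightarrow> AE \<omega> in M. 0 \<le> S u \<omega>"
    and const: "\<And>u \<omega>. m \<le> u \<Longrightarrow> S u \<omega> = S m \<omega>"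
    and N: "stock_strategy M F T N" and sf: "self_financing M F T r \<alpha> S \<eta> N"
  shows "AE \<omega> in M. \<eta> T \<omega> \<le> (1 + (1 - \<alpha>) * r) ^ (T - m) * pre_trade_value r \<alpha> S N \<eta> m \<omega>"
proof -
  let ?q = "1 + (1 - \<alpha>) * r"
  have q: "1 \<le> ?q" using \<alpha> r by simp
  have S': "AE \<omega> in M. \<forall>u\<in>{..T}. 0 \<le> S u \<omega>" using S by (subst AE_finite_all) auto
  show ?thesis
    using S' stock_strategy_nonneg[OF N] self_financing_AE[OF sf]
      stock_strategy_liquidation_value_T[OF N, of r \<alpha> S \<eta>]
  proof eventually_elim
    case (elim \<omega>)
    let ?V = "\<lambda>u. liquidation_value r \<alpha> S N \<eta> u \<omega>"
    have "?V (m + k) \<le> ?q ^ k * ?V m" if "m + k \<le> T" for k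
      using that
    proof (induction k)
      case (Suc k)
      define u where "u = m + k"
      \<comment> \<open>The after-tax proceeds are a convex combination of the selling and the
        purchase price.\<close>
      have X: "0 \<le> S u \<omega> - \<alpha> * (S u \<omega> - S s \<omega>)" if "s \<le> u" for s
      proof -
        have "0 \<le> (1 - \<alpha>) * S u \<omega> + \<alpha> * S s \<omega>"
          using elim(1) \<alpha> that Suc.prems by (auto simp: u_def)
        then show ?thesis by (simp add: algebra_simps)
      qed
      have eq: "S (Suc u) \<omega> = S u \<omega>" using const[of u \<omega>] const[of "Suc u" \<omega>] by (simp add: u_def)
      have nn: "0 \<le> (\<Sum>s\<le>u. N s u \<omega> * (S u \<omega> - \<alpha> * (S u \<omega> - S s \<omega>)))"
        using X elim(2) Suc.prems by (intro sum_nonneg mult_nonneg_nonneg) (auto simp: u_def)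
      \<comment> \<open>At an unchanged price the shares keep their after-tax value and only the
        cash grows by \<open>?q\<close>; crediting the same growth to the shares gives the upper
        bound.\<close>
      have "?V (Suc u) = ?q * \<eta> u \<omega> + (\<Sum>s\<le>u. N s u \<omega> * (S u \<omega> - \<alpha> * (S u \<omega> - S s \<omega>)))"
        using elim(3) Suc.prems
        by (simp add: pre_trade_value_def u_def[symmetric] eq lessThan_Suc_atMost del: sum.lessThan_Suc)
      also have "\<dots> \<le> ?q * ?V u"
        using mult_right_mono[OF q nn] by (simp add: liquidation_value_def ring_distribs)
      also have "\<dots> \<le> ?q * (?q ^ k * ?V m)"
        using Suc q unfolding u_def by (intro mult_left_mono) auto
      finally show ?case by (simp add: u_def)
    qed simp
    from this[of "T - m"] m elim(3,4) show ?case by simp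
  qed
qed

text \<open>This is the preceding bound for \<open>m = 0\<close>, where the value before trading is
  zero.\<close>

lemma NA_constant_price:
  assumes \<alpha>: "0 \<le> \<alpha>" "\<alpha> < 1" and r: "0 < r" and X: "AE \<omega> in M. 0 \<le> X \<omega>"
  shows "NA M F T r \<alpha> (\<lambda>_. X)"
  unfolding NA_iff
proof (intro allI impI)
  fix \<eta> N assume "stock_strategy M F T N" "self_financing M F T r \<alpha> (\<lambda>_. X) \<eta> N"
  from terminal_value_le_if_constant_price[OF \<alpha> r _ _ _ this, of 0] X
  show "AE \<omega> in M. \<eta> T \<omega> \<le> 0" by (simp add: pre_trade_value_def)
qed

section \<open>One-period arbitrages in the absence of taxes\<close>

text \<open>Without taxes wealth depends on the shares only through their total number and satisfies
  a linear recursion, with one gain term for each period. A one-period arbitrage is carried out by a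
  loan-financed purchase; conversely, an arbitrage over several periods must contain one in a single
  period.\<close>

lemma NA_no_tax_iff:
  assumes r: "0 < r" and S: "\<And>u. u \<le> T \<Longrightarrow> S u \<in> borel_measurable (F u)"
  shows "NA M F T r 0 S \<longleftrightarrow>
    (\<forall>u<T. \<forall>\<phi>\<in>L0_plus M (F u).
      (AE \<omega> in M. 0 \<le> \<phi> \<omega> * (S (Suc u) \<omega> - (1 + r) * S u \<omega>)) \<longrightarrow>
      (AE \<omega> in M. \<phi> \<omega> * (S (Suc u) \<omega> - (1 + r) * S u \<omega>) \<le> 0))"
    (is "_ \<longleftrightarrow> ?one_period")
proof
  assume NA: "NA M F T r 0 S"
  show ?one_period
  proof (intro allI ballI impI)
    fix u \<phi>
    assume u: "u < T" and \<phi>: "\<phi> \<in> L0_plus M (F u)"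
      and nonneg: "AE \<omega> in M. 0 \<le> \<phi> \<omega> * (S (Suc u) \<omega> - (1 + r) * S u \<omega>)"
    \<comment> \<open>Borrow at \<open>u\<close> to buy \<open>\<phi>\<close> shares, and do nothing
      before; the sale at \<open>Suc u\<close> is supplied by the liquidation lemma.\<close>
    define N where "N s v \<omega> = (if s = u \<and> v = u then \<phi> \<omega> else 0)" for s v :: nat and \<omega>
    define \<eta> where "\<eta> v \<omega> = (if v = u then - \<phi> \<omega> * S u \<omega> else 0)" for v :: nat and \<omega>
    have gain: "pre_trade_value r 0 S N \<eta> (Suc u) \<omega> =
        \<phi> \<omega> * (S (Suc u) \<omega> - (1 + r) * S u \<omega>)" for \<omega>
      by (simp add: pre_trade_value_def N_def \<eta>_def algebra_simps if_distrib sum.delta)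
    have "AE \<omega> in M. pre_trade_value r 0 S N \<eta> (Suc u) \<omega> \<le> 0"
    proof (rule pre_trade_value_nonpos_if_NA[OF _ _ _ _ _ _ NA])
      show "AE \<omega> in M. 0 \<le> pre_trade_value r 0 S N \<eta> (Suc u) \<omega>" using nonneg by (simp add: gain)
      show "N s v \<in> L0_plus M (F v)" if "s \<le> v" "v < Suc u" for s v
        using \<phi> by (cases "s = u \<and> v = u") (auto simp: N_def[abs_def] L0_plus_def)
      show "\<eta> v \<in> borel_measurable (F v)" if "v < Suc u" for v
        using \<phi> S[of u] u by (cases "v = u") (auto simp: \<eta>_def[abs_def] L0_plus_def)
      show "AE \<omega> in M. N s (Suc v) \<omega> \<le> N s v \<omega>" if "s \<le> v" "Suc v < Suc u" for s v
        using that by (simp add: N_def)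
      show "AE \<omega> in M. budget_equation r 0 S N \<eta> {..<v} (v - 1) v \<omega>" if "v < Suc u" for v
        using that by (auto simp: budget_equation_def N_def \<eta>_def)
    qed (use u r S in auto)
    then show "AE \<omega> in M. \<phi> \<omega> * (S (Suc u) \<omega> - (1 + r) * S u \<omega>) \<le> 0" by (simp add: gain)
  qed
next
  assume one: ?one_period
  show "NA M F T r 0 S"
    unfolding NA_iff
  proof (intro allI impI)
    fix \<eta> N
    assume N: "stock_strategy M F T N" and sf: "self_financing M F T r 0 S \<eta> N"
      and nonneg: "AE \<omega> in M. 0 \<le> \<eta> T \<omega>"
    define V where "V = liquidation_value r 0 S N \<eta>"
    define \<phi> where "\<phi> u \<omega> = (\<Sum>s\<le>u. N s u \<omega>)" for u \<omega>
    define G where "G u \<omega> = S (Suc u) \<omega> - (1 + r) * S u \<omega>" for u \<omega>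
    have \<phi>: "\<phi> u \<in> L0_plus M (F u)" if "u \<le> T" for u
    proof -
      have "\<phi> u \<in> borel_measurable (F u)"
        using N that unfolding \<phi>_def[abs_def] stock_strategy_def L0_plus_def
        by (intro borel_measurable_sum) auto
      moreover have "AE \<omega> in M. 0 \<le> \<phi> u \<omega>"
        using stock_strategy_nonneg[OF N]
        by eventually_elim (use that in \<open>auto simp: \<phi>_def intro: sum_nonneg\<close>)
      ultimately show ?thesis by (simp add: L0_plus_def)
    qed
    have V_meas: "V u \<in> borel_measurable (F u)" if "u \<le> T" for u
    proof -
      have "V u = (\<lambda>\<omega>. \<eta> u \<omega> + \<phi> u \<omega> * S u \<omega>)"
        by (simp add: V_def liquidation_value_def[abs_def] \<phi>_def sum_distrib_right)
      then show ?thesis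
        using \<phi>[OF that] S[OF that] sf that by (auto simp: L0_plus_def self_financing_def)
    qed
    have step: "AE \<omega> in M. \<forall>u<T. V (Suc u) \<omega> = (1 + r) * V u \<omega> + \<phi> u \<omega> * G u \<omega>"
      using self_financing_AE[OF sf]
    proof (eventually_elim, intro allI impI)
      fix \<omega> u
      assume eq: "\<forall>u\<le>T. liquidation_value r 0 S N \<eta> u \<omega> = pre_trade_value r 0 S N \<eta> u \<omega>"
        and u: "u < T"
      have "V (Suc u) \<omega> = (1 + r) * \<eta> u \<omega> + \<phi> u \<omega> * S (Suc u) \<omega>"
        using eq u by (simp add: V_def pre_trade_value_def \<phi>_def lessThan_Suc_atMost
            sum_distrib_right del: sum.lessThan_Suc)
      moreover have "V u \<omega> = \<eta> u \<omega> + \<phi> u \<omega> * S u \<omega>"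
        by (simp add: V_def liquidation_value_def \<phi>_def sum_distrib_right)
      ultimately show "V (Suc u) \<omega> = (1 + r) * V u \<omega> + \<phi> u \<omega> * G u \<omega>"
        by (simp add: G_def algebra_simps)
    qed
    have V0: "AE \<omega> in M. V 0 \<omega> = 0"
      using self_financing_AE[OF sf] by eventually_elim (simp add: V_def pre_trade_value_def)
    \<comment> \<open>Induction along dates shows that wealth which is nonnegative at
      \<open>u\<close> must vanish there; the case \<open>u = T\<close> excludes arbitrage.\<close>
    have V_le: "(AE \<omega> in M. 0 \<le> V u \<omega>) \<longrightarrow> (AE \<omega> in M. V u \<omega> \<le> 0)" if "u \<le> T" for u
      using that
    proof (induction u)
      case 0
      then show ?case using V0 by (auto elim: eventually_mono)
    next
      case (Suc u)
      then have u: "u < T" by simp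
      note one' = one[rule_format, OF u, folded G_def]
      show ?case
      proof
        assume pos: "AE \<omega> in M. 0 \<le> V (Suc u) \<omega>"
        \<comment> \<open>Keep the position only where current wealth is negative. Since wealth at
          \<open>Suc u\<close> is nonnegative, the gain must be strictly positive there, so this
          event is null by absence of one-period arbitrage.\<close>
        define \<psi> where "\<psi> \<omega> = (if V u \<omega> < 0 then \<phi> u \<omega> else 0)" for \<omega>
        have "\<psi> \<in> L0_plus M (F u)"
        proof -
          have [measurable]: "\<phi> u \<in> borel_measurable (F u)" "V u \<in> borel_measurable (F u)"
            using \<phi> V_meas u by (auto simp: L0_plus_def)
          have "\<psi> \<in> borel_measurable (F u)" unfolding \<psi>_def[abs_def] by measurable
          then show ?thesis using \<phi>[of u] u by (auto simp: L0_plus_def \<psi>_def)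
        qed
        moreover have gain: "AE \<omega> in M. (V u \<omega> < 0 \<longrightarrow> 0 < \<psi> \<omega> * G u \<omega>) \<and> 0 \<le> \<psi> \<omega> * G u \<omega>"
          using pos step
        proof eventually_elim
          case (elim \<omega>)
          then have *: "0 \<le> (1 + r) * V u \<omega> + \<phi> u \<omega> * G u \<omega>" using u by simp
          have "(1 + r) * V u \<omega> < 0" if "V u \<omega> < 0"
            using that r by (simp add: mult_less_0_iff)
          with * show ?case by (auto simp: \<psi>_def)
        qed
        then have "AE \<omega> in M. 0 \<le> \<psi> \<omega> * G u \<omega>" by eventually_elim auto
        ultimately have "AE \<omega> in M. \<psi> \<omega> * G u \<omega> \<le> 0" by (rule one')
        with gain have "AE \<omega> in M. 0 \<le> V u \<omega>" by eventually_elim auto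
        moreover from this have "AE \<omega> in M. V u \<omega> \<le> 0" using Suc by simp
        \<comment> \<open>Wealth at \<open>u\<close> is now zero by the induction hypothesis, so the
          wealth at \<open>Suc u\<close> is the gain of a single period.\<close>
        ultimately have eq: "AE \<omega> in M. V (Suc u) \<omega> = \<phi> u \<omega> * G u \<omega>"
          using step by eventually_elim (use u in auto)
        with pos have "AE \<omega> in M. 0 \<le> \<phi> u \<omega> * G u \<omega>" by eventually_elim simp
        with \<phi>[of u] u have "AE \<omega> in M. \<phi> u \<omega> * G u \<omega> \<le> 0" by (intro one') auto
        with eq show "AE \<omega> in M. V (Suc u) \<omega> \<le> 0" by eventually_elim simp
      qed
    qed
    have VT: "AE \<omega> in M. V T \<omega> = \<eta> T \<omega>"
      using stock_strategy_liquidation_value_T[OF N] by (simp add: V_def)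
    with nonneg have "AE \<omega> in M. 0 \<le> V T \<omega>" by eventually_elim simp
    with V_le have "AE \<omega> in M. V T \<omega> \<le> 0" by simp
    with VT show "AE \<omega> in M. \<eta> T \<omega> \<le> 0" by eventually_elim simp
  qed
qed

end

text \<open>The model with eliminated period \<open>t\<close> is an ordinary model with horizon \<open>T - 1\<close>: its \<open>i\<close>-th
  date is \<open>skip t i\<close>, where the information \<open>merged_info F t i\<close> is available.\<close>

definition skip :: "nat \<Rightarrow> nat \<Rightarrow> nat" where
  "skip t i = (if i < t then i else Suc i)"

definition merged_info :: "(nat \<Rightarrow> 'a measure) \<Rightarrow> nat \<Rightarrow> nat \<Rightarrow> 'a measure" where
  "merged_info F t i = (if Suc i < t then F i else F (Suc i))"

lemma inj_skip: "inj_on (skip t) A"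
  by (auto simp: inj_on_def skip_def split: if_splits)

lemma elim_domain_eq: "1 \<le> t \<Longrightarrow> t \<le> T \<Longrightarrow> elim_domain T t = skip t ` {..T - 1}"
proof (intro equalityI subsetI)
  fix u assume *: "1 \<le> t" "t \<le> T" "u \<in> elim_domain T t"
  then have "u = skip t (if u < t then u else u - 1)" "(if u < t then u else u - 1) \<le> T - 1"
    by (auto simp: skip_def elim_domain_def)
  then show "u \<in> skip t ` {..T - 1}" by blast
qed (auto simp: skip_def elim_domain_def split: if_splits)

text \<open>At index \<open>t - 1\<close> the date is still \<open>t - 1\<close> but the information
  is already \<open>F t\<close>; this explains the cut at \<open>Suc i < t\<close> in
  \<open>merged_info\<close>, one index earlier than in \<open>skip\<close>.\<close>

lemma elim_info_skip: "1 \<le> t \<Longrightarrow> elim_info F t (skip t i) = merged_info F t i"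
  by (auto simp: elim_info_def skip_def merged_info_def)

lemma elim_horizon_eq: "1 \<le> t \<Longrightarrow> t \<le> T \<Longrightarrow> elim_horizon T t = skip t (T - 1)"
  by (auto simp: elim_horizon_def skip_def)

lemma skip_le_iff: "skip t i \<le> skip t j \<longleftrightarrow> i \<le> j"
  by (auto simp: skip_def)

lemma budget_equation_skip:
  "budget_equation r \<alpha> S N \<eta> (skip t ` I) (skip t (i - 1)) (skip t i) \<omega> \<longleftrightarrow>
   budget_equation r \<alpha> (S \<circ> skip t) (\<lambda>s u. N (skip t s) (skip t u)) (\<eta> \<circ> skip t) I (i - 1) i \<omega>"
  if "1 \<le> t"
proof -
  \<comment> \<open>The initial date must stay fixed, because the budget equation singles out date 0
    for the zero initial capital.\<close>
  have "skip t i = 0 \<longleftrightarrow> i = 0" using that by (auto simp: skip_def)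
  then show ?thesis
    by (simp add: budget_equation_def sum.reindex[OF inj_skip])
qed

text \<open>The separate equation at \<open>t + 1\<close> arises only because its predecessor is
  \<open>t - 1\<close>. In the new numbering every index has the preceding index as its predecessor,
  and both kinds of equation take one form.\<close>

lemma elim_budget_equations_iff:
  assumes t: "1 \<le> t" "t \<le> T"
  shows "(\<forall>u\<in>elim_domain T t - {t + 1}. AE \<omega> in M.
        budget_equation r \<alpha> S N \<eta> {s \<in> elim_domain T t. s < u} (u - 1) u \<omega>) \<and>
     (t < T \<longrightarrow> (AE \<omega> in M. budget_equation r \<alpha> S N \<eta> {0..t - 1} (t - 1) (t + 1) \<omega>)) \<longleftrightarrow>
     (\<forall>i\<le>T - 1. AE \<omega> in M. budget_equation r \<alpha> S N \<eta>
        (skip t ` {..<i}) (skip t (i - 1)) (skip t i) \<omega>)"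
    (is "?L1 \<and> ?L2 \<longleftrightarrow> ?R")
proof -
  have regular: "{s \<in> elim_domain T t. s < skip t i} = skip t ` {..<i}"
    if "i \<le> T - 1" for i
    using that unfolding elim_domain_eq[OF t] by (auto simp: skip_def split: if_splits)
  \<comment> \<open>The two candidates for the previous date differ only at index \<open>t\<close>:
    subtraction gives the removed date \<open>t\<close>, while \<open>skip\<close> gives
    \<open>t - 1\<close>.\<close>
  have prev: "budget_equation r \<alpha> S N \<eta> I (skip t i - 1) (skip t i) \<omega> \<longleftrightarrow>
      budget_equation r \<alpha> S N \<eta> I (skip t (i - 1)) (skip t i) \<omega>" if "i \<noteq> t" for i I \<omega>
  proof (cases "i = 0")
    case True
    then show ?thesis using t by (simp add: skip_def budget_equation_def)
  next
    case False
    with that have "skip t i - 1 = skip t (i - 1)" by (auto simp: skip_def)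
    then show ?thesis by simp
  qed
  have "elim_domain T t - {t + 1} = skip t ` ({..T - 1} - {t})"
    unfolding elim_domain_eq[OF t] using t by (auto simp: skip_def split: if_splits)
  then have "?L1 \<longleftrightarrow> (\<forall>i\<in>{..T - 1} - {t}. AE \<omega> in M. budget_equation r \<alpha> S N \<eta>
        (skip t ` {..<i}) (skip t (i - 1)) (skip t i) \<omega>)"
    using regular prev by (simp del: One_nat_def)
  moreover have "skip t ` {..<t} = {0..t - 1}" "skip t (t - 1) = t - 1" "skip t t = t + 1"
    using t by (auto simp: skip_def image_def)
  \<comment> \<open>The intersection is empty exactly when \<open>t = T\<close>, in agreement with
    the premise \<open>t < T\<close> of \<open>?L2\<close>.\<close>
  then have "?L2 \<longleftrightarrow> (\<forall>i\<in>{..T - 1} \<inter> {t}. AE \<omega> in M. budget_equation r \<alpha> S N \<eta>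
        (skip t ` {..<i}) (skip t (i - 1)) (skip t i) \<omega>)"
    using t by auto
  ultimately show ?thesis by blast
qed

section \<open>Transfer of strategies and (NA) to the renumbered model\<close>

context filtered_prob_space
begin

text \<open>Through this fact the results for ordinary models apply to the model with eliminated
  period by interpretation.\<close>

lemma filtered_prob_space_merged_info:
  "filtered_prob_space M (merged_info F t) (T - 1)" if "1 \<le> t" "t \<le> T"
proof (unfold_locales)
  show "subalgebra M (merged_info F t i)" if "i \<le> T - 1" for i
    using that \<open>1 \<le> t\<close> \<open>t \<le> T\<close> by (auto simp: merged_info_def intro!: subalgebra_F)
  show "sets (merged_info F t i) \<subseteq> sets (merged_info F t j)" if "i \<le> j" "j \<le> T - 1" for i j
    using that \<open>1 \<le> t\<close> \<open>t \<le> T\<close> F_mono[of i j] F_mono[of i "Suc j"] F_mono[of "Suc i" "Suc j"]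
    by (auto simp: merged_info_def)
qed

text \<open>Ordinary strategies are required to decrease between successive dates, those of the
  eliminated model between any two dates; this bridges the formulations.\<close>

lemma stock_strategy_antimono:
  assumes N: "stock_strategy M F T N" and "s \<le> u" "u \<le> v" "v \<le> T"
  shows "AE \<omega> in M. N s v \<omega> \<le> N s u \<omega>"
  using assms(3,4)
proof (induction v rule: dec_induct)
  case (step v)
  have "AE \<omega> in M. N s (Suc v) \<omega> \<le> N s v \<omega>"
    using N step assms(2) by (auto simp: stock_strategy_def)
  moreover have "AE \<omega> in M. N s v \<omega> \<le> N s u \<omega>" using step by simp
  ultimately show ?case by eventually_elim simp
qed simp

lemma elim_stock_strategy_iff:
  assumes t: "1 \<le> t" "t \<le> T"
  shows "elim_stock_strategy M F T t N \<longleftrightarrow>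
    stock_strategy M (merged_info F t) (T - 1) (\<lambda>s u. N (skip t s) (skip t u))"
    (is "?elim \<longleftrightarrow> stock_strategy M ?G ?H ?N")
proof -
  interpret G: filtered_prob_space M ?G ?H
    by (rule filtered_prob_space_merged_info) (use t in auto)
  have "?elim \<longleftrightarrow>
      (\<forall>s\<le>?H. \<forall>u\<le>?H. s \<le> u \<longrightarrow> ?N s u \<in> L0_plus M (?G u)) \<and>
      (\<forall>s\<le>?H. \<forall>u\<le>?H. \<forall>v\<le>?H. s \<le> u \<and> u \<le> v \<longrightarrow> (AE \<omega> in M. ?N s v \<omega> \<le> ?N s u \<omega>)) \<and>
      (\<forall>s\<le>?H. AE \<omega> in M. ?N s ?H \<omega> = 0)"
    unfolding elim_stock_strategy_def elim_domain_eq[OF t] elim_horizon_eq[OF t]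
    by (simp add: skip_le_iff elim_info_skip[OF t(1)]) (simp add: Ball_def)
  also have "\<dots> \<longleftrightarrow> stock_strategy M ?G ?H ?N"
    using G.stock_strategy_antimono[of ?N] unfolding stock_strategy_def
    by (auto simp del: One_nat_def)
  finally show ?thesis .
qed

lemma elim_self_financing_iff:
  assumes t: "1 \<le> t" "t \<le> T"
  shows "elim_self_financing M F T t r \<alpha> S \<eta> N \<longleftrightarrow>
    self_financing M (merged_info F t) (T - 1) r \<alpha> (S \<circ> skip t) (\<eta> \<circ> skip t)
      (\<lambda>s u. N (skip t s) (skip t u))"
proof -
  have "(\<forall>u\<in>elim_domain T t. \<eta> u \<in> borel_measurable (elim_info F t u)) \<longleftrightarrow>
      (\<forall>i\<le>T - 1. (\<eta> \<circ> skip t) i \<in> borel_measurable (merged_info F t i))"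
    unfolding elim_domain_eq[OF t] by (auto simp: elim_info_skip[OF t(1)])
  then show ?thesis
    unfolding elim_self_financing_def self_financing_def elim_budget_equations_iff[OF t]
      budget_equation_skip[OF t(1)]
    by blast
qed

lemma elim_NA_iff:
  assumes t: "1 \<le> t" "t \<le> T"
  shows "elim_NA M F T t r \<alpha> S \<longleftrightarrow> NA M (merged_info F t) (T - 1) r \<alpha> (S \<circ> skip t)"
proof -
  \<comment> \<open>A left inverse of \<open>skip t\<close>; composing with it turns strategies of
    the renumbered model into strategies on the original dates.\<close>
  define p where "p u = (if u < t then u else u - 1)" for u
  have p: "p (skip t i) = i" for i by (auto simp: p_def skip_def)
  let ?good = "\<lambda>X. \<P>(\<omega> in M. 0 \<le> X \<omega>) = 1 \<and> \<P>(\<omega> in M. 0 < X \<omega>) > (0::real)"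
  let ?arb = "\<lambda>\<eta> N. stock_strategy M (merged_info F t) (T - 1) N \<and>
      self_financing M (merged_info F t) (T - 1) r \<alpha> (S \<circ> skip t) \<eta> N \<and> ?good (\<eta> (T - 1))"
  have "elim_NA M F T t r \<alpha> S \<longleftrightarrow>
      (\<nexists>\<eta> N. ?arb (\<eta> \<circ> skip t) (\<lambda>s u. N (skip t s) (skip t u)))"
    unfolding elim_NA_def elim_stock_strategy_iff[OF t] elim_self_financing_iff[OF t]
      elim_horizon_eq[OF t] comp_apply ..
  also have "\<dots> \<longleftrightarrow> (\<nexists>\<eta> N. ?arb \<eta> N)"
  proof -
    have "\<exists>\<eta>' N'. ?arb (\<eta>' \<circ> skip t) (\<lambda>s u. N' (skip t s) (skip t u))" if "?arb \<eta> N" for \<eta> N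
    proof (intro exI)
      show "?arb ((\<eta> \<circ> p) \<circ> skip t) (\<lambda>s u. (\<lambda>s u. N (p s) (p u)) (skip t s) (skip t u))"
        using that by (simp only: comp_def p)
    qed
    then show ?thesis by blast
  qed
  finally show ?thesis unfolding NA_def .
qed

lemma L0_plus_F_mono:
  assumes "s \<le> t" "t \<le> T" "X \<in> L0_plus M (F s)"
  shows "X \<in> L0_plus M (F t)"
  using assms borel_measurable_F_mono by (auto simp: L0_plus_def)

section \<open>From (RLNA) to (NA) by successive stopping\<close>

text \<open>A terminal value is bounded by the compounded value \<open>?W\<close> of selling
  everything at \<open>m\<close>. Only positions held before \<open>m\<close> enter
  \<open>?W\<close>, and these use no advance information, so (NA) of the ordinary model applies to
  it.\<close>

lemma elim_NA_stopped_price: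
  assumes \<alpha>: "0 \<le> \<alpha>" "\<alpha> < 1" and r: "0 < r" and m: "m < T"
    and S: "price_process M F {0..T} S"
    and NA: "NA M F T r \<alpha> (\<lambda>u. S (min u m))"
  shows "elim_NA M F T (Suc m) r \<alpha> (\<lambda>u. S (min u m))"
proof -
  let ?G = "merged_info F (Suc m)" and ?H = "T - 1" and ?S = "\<lambda>u. S (min u m)"
  interpret G: filtered_prob_space M ?G ?H
    by (rule filtered_prob_space_merged_info) (use m in auto)
  have q: "0 < 1 + (1 - \<alpha>) * r" using \<alpha> r by (simp add: add_pos_pos)
  \<comment> \<open>The stopped price is constant from \<open>m\<close> on, so leaving out the date
    \<open>Suc m\<close> does not alter it.\<close>
  have [simp]: "?S \<circ> skip (Suc m) = ?S" by (auto simp: skip_def min_def fun_eq_iff)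
  have G: "?G u = F u" if "u < m" for u using that by (simp add: merged_info_def)
  have "NA M ?G ?H r \<alpha> ?S"
    unfolding G.NA_iff
  proof (intro allI impI)
    fix \<eta> N
    assume N: "stock_strategy M ?G ?H N" and sf: "self_financing M ?G ?H r \<alpha> ?S \<eta> N"
      and nonneg: "AE \<omega> in M. 0 \<le> \<eta> ?H \<omega>"
    let ?W = "pre_trade_value r \<alpha> ?S N \<eta> m"
    have S_nonneg: "AE \<omega> in M. 0 \<le> ?S u \<omega>" for u
      using S m by (auto simp: price_process_def L0_plus_def)
    have le: "AE \<omega> in M. \<eta> ?H \<omega> \<le> (1 + (1 - \<alpha>) * r) ^ (?H - m) * ?W \<omega>"
      by (rule G.terminal_value_le_if_constant_price[OF \<alpha> r _ S_nonneg _ N sf]) (use m in auto)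
    have "AE \<omega> in M. ?W \<omega> \<le> 0"
    proof (rule pre_trade_value_nonpos_if_NA[OF _ _ _ _ _ _ NA _ q])
      show "AE \<omega> in M. 0 \<le> ?W \<omega>"
        using nonneg le
      proof eventually_elim
        case (elim \<omega>)
        then have "0 \<le> (1 + (1 - \<alpha>) * r) ^ (?H - m) * ?W \<omega>" by linarith
        then show ?case using zero_less_power[OF q, of "?H - m"] by (auto simp: zero_le_mult_iff)
      qed
      show "?S u \<in> borel_measurable (F u)" if "u \<le> m" for u
        using S m that by (auto simp: price_process_def L0_plus_def)
      show "N s u \<in> L0_plus M (F u)" if "s \<le> u" "u < m" for s u
        using N that m by (auto simp: stock_strategy_def G[symmetric])
      show "AE \<omega> in M. N s (Suc u) \<omega> \<le> N s u \<omega>" if "s \<le> u" "Suc u < m" for s u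
        using N that m by (auto simp: stock_strategy_def)
      show "\<eta> u \<in> borel_measurable (F u)" if "u < m" for u
        using sf that m by (auto simp: self_financing_def G[symmetric])
      show "AE \<omega> in M. budget_equation r \<alpha> ?S N \<eta> {..<u} (u - 1) u \<omega>" if "u < m" for u
        using sf that m by (simp add: self_financing_def del: One_nat_def)
    qed (use m in auto)
    with le show "AE \<omega> in M. \<eta> ?H \<omega> \<le> 0"
    proof eventually_elim
      case (elim \<omega>)
      have "(1 + (1 - \<alpha>) * r) ^ (?H - m) * ?W \<omega> \<le> 0"
        using elim(2) zero_less_power[OF q, of "?H - m"] by (simp add: mult_le_0_iff)
      with elim(1) show ?case by linarith
    qed
  qed
  then show ?thesis using m by (subst elim_NA_iff) auto
qed

lemma prob_jump_from_zero_iff: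
  assumes S: "price_process M F {0..T} S" and t: "1 \<le> t" "t \<le> T"
  shows "\<P>(\<omega> in M. S (t - 1) \<omega> = 0 \<and> S t \<omega> > 0) = 0 \<longleftrightarrow>
    (AE \<omega> in M. S (t - 1) \<omega> = 0 \<longrightarrow> S t \<omega> = 0)"
proof -
  have [measurable]: "S u \<in> borel_measurable M" if "u \<le> T" for u
    using S that by (intro borel_measurable_F_M[of u]) (auto simp: price_process_def L0_plus_def)
  have [measurable]: "S (t - 1) \<in> borel_measurable M" "S t \<in> borel_measurable M"
    using t by auto
  have nonneg: "AE \<omega> in M. 0 \<le> S t \<omega>" using S t by (auto simp: price_process_def L0_plus_def)
  have "\<P>(\<omega> in M. S (t - 1) \<omega> = 0 \<and> S t \<omega> > 0) = 0 \<longleftrightarrow>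
    (AE \<omega> in M. \<not> (S (t - 1) \<omega> = 0 \<and> S t \<omega> > 0))"
    by (rule prob_Collect_eq_0) measurable
  also have "\<dots> \<longleftrightarrow> (AE \<omega> in M. S (t - 1) \<omega> = 0 \<longrightarrow> S t \<omega> = 0)"
  proof
    assume "AE \<omega> in M. \<not> (S (t - 1) \<omega> = 0 \<and> S t \<omega> > 0)"
    with nonneg show "AE \<omega> in M. S (t - 1) \<omega> = 0 \<longrightarrow> S t \<omega> = 0" by eventually_elim auto
  qed auto
  finally show ?thesis .
qed

lemma NA_if_RLNA:
  assumes \<alpha>: "0 \<le> \<alpha>" "\<alpha> < 1" and r: "0 < r" and S: "price_process M F {0..T} S"
    and RLNA: "RLNA M F T r \<alpha> S"
  shows "NA M F T r \<alpha> S"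
proof -
  have "NA M F T r \<alpha> (\<lambda>u. S (min u k))" if "k \<le> T" for k
    using that
  proof (induction k)
    case 0
    have "AE \<omega> in M. 0 \<le> S 0 \<omega>" using S by (simp add: price_process_def L0_plus_def)
    then show ?case using NA_constant_price[OF \<alpha> r] by simp
  next
    case (Suc k)
    then have k: "k < T" and IH: "NA M F T r \<alpha> (\<lambda>u. S (min u k))" by auto
    have period: "RLNA_in_period M F T r \<alpha> S (Suc k)"
      using RLNA k by (simp add: RLNA_def)
    \<comment> \<open>The stopped process is adapted, as \<open>min u k\<close> never exceeds
      \<open>u\<close>.\<close>
    have "price_process M F (elim_domain T (Suc k)) (\<lambda>u. S (min u k))"
      unfolding price_process_def
    proof
      fix u assume "u \<in> elim_domain T (Suc k)"
      then have "u \<le> T" by (simp add: elim_domain_def)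
      then show "S (min u k) \<in> L0_plus M (F u)"
        using S by (intro L0_plus_F_mono[of "min u k" u]) (auto simp: price_process_def)
    qed
    with period elim_NA_stopped_price[OF \<alpha> r k S IH]
    have NA: "NA M F T r \<alpha> (insert_period (Suc k) S (\<lambda>u. S (min u k)))"
      by (simp add: RLNA_in_period_def)
    have zero: "AE \<omega> in M. S k \<omega> = 0 \<longrightarrow> S (Suc k) \<omega> = 0"
      using period prob_jump_from_zero_iff[OF S, of "Suc k"] k by (simp add: RLNA_in_period_def)
    \<comment> \<open>Where \<open>S k\<close> is nonzero the factor \<open>S k\<close> cancels;
      where it is zero, the inserted price is zero and so is \<open>S (Suc k)\<close> almost
      surely.\<close>
    show ?case
    proof (rule NA_cong_AE[OF _ NA])
      fix u
      show "AE \<omega> in M. insert_period (Suc k) S (\<lambda>u. S (min u k)) u \<omega> = S (min u (Suc k)) \<omega>"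
        using zero by eventually_elim (auto simp: insert_period_def min_def)
    qed
  qed
  from NA_cong_AE[OF _ this[OF order_refl], of S] show ?thesis by simp
qed

section \<open>From (NA) to (RLNA) at tax rate zero\<close>

lemma RLNA_in_period_no_tax_if_NA:
  assumes r: "0 < r" and S: "price_process M F {0..T} S" and NA: "NA M F T r 0 S"
    and t: "1 \<le> t" "t \<le> T"
  shows "RLNA_in_period M F T r 0 S t"
  unfolding RLNA_in_period_def
proof (intro conjI allI impI)
  have S_meas: "S u \<in> borel_measurable (F u)" if "u \<le> T" for u
    using S that by (simp add: price_process_def L0_plus_def)
  have S_nonneg: "AE \<omega> in M. 0 \<le> S u \<omega>" if "u \<le> T" for u
    using S that by (simp add: price_process_def L0_plus_def)
  have t': "t - 1 < T" "Suc (t - 1) = t" using t by auto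
  have no_arb: "AE \<omega> in M. \<phi> \<omega> * (S t \<omega> - (1 + r) * S (t - 1) \<omega>) \<le> 0"
    if "\<phi> \<in> L0_plus M (F (t - 1))" "AE \<omega> in M. 0 \<le> \<phi> \<omega> * (S t \<omega> - (1 + r) * S (t - 1) \<omega>)" for \<phi>
  proof -
    have "\<forall>u<T. \<forall>\<phi>\<in>L0_plus M (F u).
        (AE \<omega> in M. 0 \<le> \<phi> \<omega> * (S (Suc u) \<omega> - (1 + r) * S u \<omega>)) \<longrightarrow>
        (AE \<omega> in M. \<phi> \<omega> * (S (Suc u) \<omega> - (1 + r) * S u \<omega>) \<le> 0)"
      using NA NA_no_tax_iff[OF r S_meas] by blast
    from this[rule_format, OF t'(1), unfolded t'(2), OF that] show ?thesis .
  qed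
  have [measurable]: "S (t - 1) \<in> borel_measurable (F (t - 1))" using S_meas t by simp
  have zero: "AE \<omega> in M. S (t - 1) \<omega> = 0 \<longrightarrow> S t \<omega> = 0"
  proof -
    \<comment> \<open>Buy one share whenever it is free: this costs nothing and cannot lose.\<close>
    define \<phi> where "\<phi> \<omega> = (if S (t - 1) \<omega> = 0 then 1 else 0 :: real)" for \<omega>
    have "\<phi> \<in> borel_measurable (F (t - 1))" unfolding \<phi>_def[abs_def] by measurable
    then have "\<phi> \<in> L0_plus M (F (t - 1))" by (simp add: L0_plus_def \<phi>_def)
    moreover have "AE \<omega> in M. 0 \<le> \<phi> \<omega> * (S t \<omega> - (1 + r) * S (t - 1) \<omega>)"
      using S_nonneg[OF t(2)] by eventually_elim (simp add: \<phi>_def)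
    ultimately have "AE \<omega> in M. \<phi> \<omega> * (S t \<omega> - (1 + r) * S (t - 1) \<omega>) \<le> 0" by (rule no_arb)
    with S_nonneg[OF t(2)] show ?thesis by eventually_elim (auto simp: \<phi>_def)
  qed
  then show "\<P>(\<omega> in M. S (t - 1) \<omega> = 0 \<and> S t \<omega> > 0) = 0"
    using prob_jump_from_zero_iff[OF S t] by simp
  fix S'
  assume S': "price_process M F (elim_domain T t) S'" and elim: "elim_NA M F T t r 0 S'"
  let ?G = "merged_info F t" and ?H = "T - 1"
  interpret G: filtered_prob_space M ?G ?H by (rule filtered_prob_space_merged_info[OF t])
  define R where "R \<omega> = S t \<omega> / S (t - 1) \<omega>" for \<omega>
  have R: "R \<in> L0_plus M (F u)" if "t \<le> u" "u \<le> T" for u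
  proof -
    have [measurable]: "S t \<in> borel_measurable (F u)" "S (t - 1) \<in> borel_measurable (F u)"
      using that t borel_measurable_F_mono[OF _ _ S_meas[of t], of u]
        borel_measurable_F_mono[OF _ _ S_meas[of "t - 1"], of u] by auto
    have "R \<in> borel_measurable (F u)" unfolding R_def[abs_def] by measurable
    moreover have "AE \<omega> in M. 0 \<le> S (t - 1) \<omega>" using S_nonneg[of "t - 1"] t by simp
    with S_nonneg[OF t(2)] have "AE \<omega> in M. 0 \<le> R \<omega>" by eventually_elim (simp add: R_def)
    ultimately show ?thesis by (simp add: L0_plus_def)
  qed
  have mult: "(\<lambda>\<omega>. X \<omega> * Y \<omega>) \<in> L0_plus M (F u)"
    if "X \<in> L0_plus M (F u)" "Y \<in> L0_plus M (F u)" for X Y u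
    using that by (auto simp: L0_plus_def)
  have S'_F: "S' u \<in> L0_plus M (F u)" if "u \<le> T" "u \<noteq> t" for u
    using S' that by (simp add: price_process_def elim_domain_def)
  define Z where "Z = S' \<circ> skip t"
  \<comment> \<open>At index \<open>t - 1\<close> the price is measurable for
    \<open>F (t - 1)\<close>, hence for the larger \<open>F t\<close> as well.\<close>
  have Z_meas: "Z i \<in> borel_measurable (?G i)" if "i \<le> ?H" for i
  proof -
    have "S' (skip t i) \<in> borel_measurable (F (skip t i))"
      using S'_F[of "skip t i"] that t by (auto simp: skip_def L0_plus_def split: if_splits)
    then show ?thesis
      using that t borel_measurable_F_mono[of i "Suc i"]
      by (auto simp: Z_def merged_info_def skip_def split: if_splits)
  qed
  have elim_arb: "AE \<omega> in M. \<phi> \<omega> * (Z (Suc i) \<omega> - (1 + r) * Z i \<omega>) \<le> 0"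
    if "i < ?H" "\<phi> \<in> L0_plus M (?G i)" "AE \<omega> in M. 0 \<le> \<phi> \<omega> * (Z (Suc i) \<omega> - (1 + r) * Z i \<omega>)"
    for i \<phi>
  proof -
    have "NA M ?G ?H r 0 Z" using elim elim_NA_iff[OF t] by (simp add: Z_def)
    then show ?thesis using G.NA_no_tax_iff[OF r Z_meas] that by blast
  qed
  let ?P = "insert_period t S S'"
  have before: "?P u = Z u" if "u < t" for u
    using that by (simp add: insert_period_def Z_def skip_def fun_eq_iff)
  have after: "?P u \<omega> = Z (u - 1) \<omega> * R \<omega>" if "t \<le> u" for u \<omega>
    using that t by (auto simp: insert_period_def Z_def skip_def R_def)
  show "NA M F T r 0 ?P"
  proof (subst NA_no_tax_iff[OF r])
    show "?P u \<in> borel_measurable (F u)" if u: "u \<le> T" for u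
    proof (cases "u < t")
      case True
      then show ?thesis using S'_F[of u] u by (simp add: before Z_def skip_def L0_plus_def)
    next
      case False
      have "?G (u - 1) = F u" using False t by (auto simp: merged_info_def)
      then have [measurable]: "Z (u - 1) \<in> borel_measurable (F u)" "R \<in> borel_measurable (F u)"
        using Z_meas[of "u - 1"] R[of u] u False by (auto simp: L0_plus_def)
      have "?P u = (\<lambda>\<omega>. Z (u - 1) \<omega> * R \<omega>)" using False by (simp add: after fun_eq_iff)
      also have "\<dots> \<in> borel_measurable (F u)" by measurable
      finally show ?thesis .
    qed
    show "\<forall>u<T. \<forall>\<phi>\<in>L0_plus M (F u).
        (AE \<omega> in M. 0 \<le> \<phi> \<omega> * (?P (Suc u) \<omega> - (1 + r) * ?P u \<omega>)) \<longrightarrow>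
        (AE \<omega> in M. \<phi> \<omega> * (?P (Suc u) \<omega> - (1 + r) * ?P u \<omega>) \<le> 0)"
    proof (intro allI ballI impI)
      fix u \<phi>
      assume u: "u < T" and \<phi>: "\<phi> \<in> L0_plus M (F u)"
        and nonneg: "AE \<omega> in M. 0 \<le> \<phi> \<omega> * (?P (Suc u) \<omega> - (1 + r) * ?P u \<omega>)"
      consider "Suc u < t" | "Suc u = t" | "t \<le> u" by linarith
      then show "AE \<omega> in M. \<phi> \<omega> * (?P (Suc u) \<omega> - (1 + r) * ?P u \<omega>) \<le> 0"
      proof cases
        case 1
        then have "?G u = F u" "u < ?H" using t by (auto simp: merged_info_def)
        then show ?thesis using elim_arb[of u \<phi>] \<phi> nonneg 1 by (simp add: before)
      next
        case 2
        \<comment> \<open>Between \<open>t - 1\<close> and \<open>t\<close> the inserted price moves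
          like \<open>S\<close> scaled by \<open>S' u / S u\<close>. This factor is known at
          \<open>u\<close>, so the position can be rescaled to one in \<open>S\<close>.\<close>
        define \<psi> where "\<psi> \<omega> = \<phi> \<omega> * (S' u \<omega> * (1 / S u \<omega>))" for \<omega>
        have inv: "(\<lambda>\<omega>. 1 / S u \<omega>) \<in> L0_plus M (F u)"
          using S_meas[of u] S_nonneg[of u] u by (auto simp: L0_plus_def)
        have \<psi>: "\<psi> \<in> L0_plus M (F u)"
          unfolding \<psi>_def[abs_def] using S'_F[of u] u 2 by (intro mult \<phi> inv) auto
        have t1: "t - 1 = u" using 2 by simp
        have P: "?P u \<omega> = S' u \<omega>" "?P (Suc u) \<omega> = S' u \<omega> * (S t \<omega> / S u \<omega>)" for \<omega>
          using 2 by (auto simp: insert_period_def)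
        have "AE \<omega> in M. 0 \<le> \<psi> \<omega> * (S t \<omega> - (1 + r) * S u \<omega>)"
          using nonneg
        proof eventually_elim
          case (elim \<omega>)
          then show ?case
            by (cases "S u \<omega> = 0") (simp_all add: \<psi>_def P field_simps)
        qed
        with \<psi> have "AE \<omega> in M. \<psi> \<omega> * (S t \<omega> - (1 + r) * S u \<omega>) \<le> 0"
          by (rule no_arb[unfolded t1])
        moreover have "AE \<omega> in M. 0 \<le> \<phi> \<omega>" "AE \<omega> in M. 0 \<le> S' u \<omega>"
          using \<phi> S'_F[of u] u 2 by (auto simp: L0_plus_def)
        ultimately show ?thesis
        proof eventually_elim
          case (elim \<omega>)
          \<comment> \<open>Where \<open>S u\<close> is zero, division by zero makes
            \<open>\<psi>\<close> vanish and says nothing about \<open>\<phi>\<close>. There the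
            inserted price falls to zero, and the gain is minus this quantity.\<close>
          have "0 \<le> (1 + r) * (\<phi> \<omega> * S' u \<omega>)" using elim r by simp
          with elim show ?case
            by (cases "S u \<omega> = 0") (simp_all add: \<psi>_def P field_simps)
        qed
      next
        case 3
        define \<psi> where "\<psi> \<omega> = \<phi> \<omega> * R \<omega>" for \<omega>
        have u': "u - 1 < ?H" "Suc (u - 1) = u" using u 3 t by auto
        \<comment> \<open>The return \<open>R\<close> is known from date \<open>t\<close> on, so
          \<open>\<phi> * R\<close> is an admissible position at index \<open>u - 1\<close>. For
          \<open>u = t\<close> this relies on the information of \<open>t\<close> being available at
          \<open>t - 1\<close>.\<close>
        have "?G (u - 1) = F u" using 3 t by (auto simp: merged_info_def)
        then have \<psi>: "\<psi> \<in> L0_plus M (?G (u - 1))"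
          using R[of u] \<phi> 3 u unfolding \<psi>_def[abs_def] by (simp add: mult)
        have "\<phi> \<omega> * (?P (Suc u) \<omega> - (1 + r) * ?P u \<omega>) = \<psi> \<omega> * (Z u \<omega> - (1 + r) * Z (u - 1) \<omega>)"
          for \<omega> using 3 by (simp add: after \<psi>_def algebra_simps)
        then show ?thesis using elim_arb[OF u'(1) \<psi>] nonneg unfolding u'(2) by simp
      qed
    qed
  qed
qed

end

theorem proposition2p11:
  fixes M :: "'a measure" and F :: "nat \<Rightarrow> 'a measure" and T :: nat
    and r :: real and S :: "nat \<Rightarrow> 'a \<Rightarrow> real"
  assumes "filtered_prob_space M F T"
    and "1 \<le> T"
    and "0 < r"
    and "price_process M F {0..T} S"
  shows "(\<forall>\<alpha>::real. 0 \<le> \<alpha> \<and> \<alpha> < 1 \<longrightarrow> RLNA M F T r \<alpha> S \<longrightarrow> NA M F T r \<alpha> S) \<and>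
         (RLNA M F T r 0 S \<longleftrightarrow> NA M F T r 0 S)"
proof -
  interpret filtered_prob_space M F T by fact
  have "RLNA M F T r 0 S" if "NA M F T r 0 S"
    unfolding RLNA_def using RLNA_in_period_no_tax_if_NA[OF assms(3,4) that] by simp
  moreover have "NA M F T r \<alpha> S" if "0 \<le> \<alpha>" "\<alpha> < 1" "RLNA M F T r \<alpha> S" for \<alpha>
    by (rule NA_if_RLNA[OF that(1,2) assms(3,4) that(3)])
  ultimately show ?thesis by (metis order_refl zero_less_one)
qed

end
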